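(* Let $n\ge 1$ and let $K_{1,n}$ be the star with $n$ leaves. When $n$ is odd, $\chi_g^{\infty3}(K_{1,n})=3$; when $n \geq 4$ is even, $\chi_g^{\infty3}(K_{1,n})=4$.
   Context: The eternal vertex coloring game (A-game) on a finite undirected graph $G$ with color set $\{1,\ldots,k\}$: all vertices are initially uncolored. Alice and Bob strictly alternate turns, Alice moving first overall. On a turn the player chooses one vertex. If it is uncolored, the player must give it a color not currently used on any of its neighbors; if it currently has color $c$, the player must change its color to a color different from $c$ that is not currently used on any of its neighbors. Play proceeds in rounds: every vertex must be chosen $t$ times before any vertex is chosen $t+1$ times, for every integer $t\ge 1$ (so each vertex is chosen exactly once per round; turns keep alternating across rounds, so if $|V(G)|$ is odd Bob moves first in even-numbered rounds). If some player chooses a vertex $v$ (still available in the current round) that cannot be legally colored, i.e. every color in the color set other than the current color of $v$ (if any) appears on a neighbor of $v$, then Bob wins. In particular Bob may deliberately choose such a vertex. Alice wins if this never happens (the game goes on forever). The (eternal) Very Greedy Coloring Game is the same game with the additional restriction that both Alice and Bob must color or re-color whatever vertex they choose with the smallest legal color (the smallest integer in $\{1,\ldots,k\}$ different from the vertex's current color, if any, and not used on any of its neighbors); so players only choose which vertex to play. $\chi_g^{\infty3}(G)$ denotes the minimum $k$ such that Alice has a winning strategy in this eternal game on $G$ with $k$ colors. *)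

theory Defs
  imports "Graph_Theory.Graph_Theory" "HOL-Library.Extended_Nat"
begin

text \<open>
  As in \<^theory>\<open>Graph_Theory.Kuratowski\<close>, an undirected graph is a symmetric digraph (locale
  \<^locale>\<open>graph\<close>): the neighbours of \<open>v\<close> are the \<open>w\<close> with \<open>v \<rightarrow>\<^bsub>G\<^esub> w\<close>, and \<open>K\<^bsub>1,n\<^esub> G\<close> says that
  \<open>G\<close> is a star with \<open>n\<close> leaves. The following lemma shows that such graphs exist.
\<close>

lemma star_exists:
  "K\<^bsub>1,n\<^esub> (with_proj \<lparr>pverts = {0..n}, parcs = {0} \<times> {1..n} \<union> {1..n} \<times> {0}\<rparr>)"
  unfolding complete_bipartite_digraph_pair_def
  by (intro conjI exI[of _ "{0}"] exI[of _ "{1..n}"]) auto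


section \<open>The eternal vertex colouring game\<close>

text \<open>
  A partial colouring maps uncoloured vertices to \<open>None\<close>. For an uncoloured vertex the condition
  \<open>c v \<noteq> Some x\<close> is vacuous, so first colouring and recolouring are covered uniformly.
\<close>

definition legal_colors ::
    "('a, 'b) pre_digraph \<Rightarrow> nat \<Rightarrow> ('a \<Rightarrow> nat option) \<Rightarrow> 'a \<Rightarrow> nat set" where
  "legal_colors G k c v =
    {x \<in> {1..k}. c v \<noteq> Some x \<and> (\<forall>w. v \<rightarrow>\<^bsub>G\<^esub> w \<longrightarrow> c w \<noteq> Some x)}"

text \<open>
  In the Very Greedy game the colour used is determined by the chosen vertex, so a finite play is
  recorded as the list \<open>h\<close> of the vertices chosen so far, in chronological order. The round
  structure: every vertex must be chosen \<open>t\<close> times before any vertex is chosen \<open>t + 1\<close> times.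
  A vertex without legal colour may well be available.
\<close>

definition available :: "('a, 'b) pre_digraph \<Rightarrow> 'a list \<Rightarrow> 'a set" where
  "available G h = {v \<in> verts G. \<forall>w \<in> verts G. count_list h v \<le> count_list h w}"

text \<open>
  The value of \<open>greedy_color\<close> is irrelevant if the vertex has no legal colour: the game has then
  been won by Bob.
\<close>

definition greedy_color ::
    "('a, 'b) pre_digraph \<Rightarrow> nat \<Rightarrow> ('a \<Rightarrow> nat option) \<Rightarrow> 'a \<Rightarrow> ('a \<Rightarrow> nat option)" where
  "greedy_color G k c v = c(v \<mapsto> Min (legal_colors G k c v))"

definition coloring_after ::
    "('a, 'b) pre_digraph \<Rightarrow> nat \<Rightarrow> 'a list \<Rightarrow> ('a \<Rightarrow> nat option)" where
  "coloring_after G k h = foldl (greedy_color G k) Map.empty h"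

text \<open>
  A strategy for Alice maps each history to her next vertex. Turns alternate throughout, with
  Alice moving first, so she moves exactly after histories of even length. The finite plays in
  which Alice follows \<open>\<sigma>\<close> and Bob chooses arbitrary available vertices:
\<close>

inductive play :: "('a, 'b) pre_digraph \<Rightarrow> ('a list \<Rightarrow> 'a) \<Rightarrow> 'a list \<Rightarrow> bool"
  for G :: "('a, 'b) pre_digraph" and \<sigma> :: "'a list \<Rightarrow> 'a" where
  start: "play G \<sigma> []"
| alice: "play G \<sigma> h \<Longrightarrow> even (length h) \<Longrightarrow> play G \<sigma> (h @ [\<sigma> h])"
| bob: "play G \<sigma> h \<Longrightarrow> odd (length h) \<Longrightarrow> v \<in> available G h \<Longrightarrow> play G \<sigma> (h @ [v])"

text \<open>
  Alice wins iff no player ever chooses a vertex without legal colour. Availability is a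
  constraint only on the choices of \<open>\<sigma>\<close>, since Bob's choices are available by definition.
\<close>

definition winning_strategy ::
    "('a, 'b) pre_digraph \<Rightarrow> nat \<Rightarrow> ('a list \<Rightarrow> 'a) \<Rightarrow> bool" where
  "winning_strategy G k \<sigma> \<longleftrightarrow>
    (\<forall>h v. play G \<sigma> (h @ [v]) \<longrightarrow>
      v \<in> available G h \<and> legal_colors G k (coloring_after G k h) v \<noteq> {})"

definition alice_wins :: "('a, 'b) pre_digraph \<Rightarrow> nat \<Rightarrow> bool" where
  "alice_wins G k \<longleftrightarrow> (\<exists>\<sigma>. winning_strategy G k \<sigma>)"

text \<open>
  The minimum is taken in \<^typ>\<open>enat\<close>, so that it is infinite (rather than arbitrary) if no number
  of colours suffices.
\<close>

definition very_greedy_eternal_chromatic_number :: "('a, 'b) pre_digraph \<Rightarrow> enat" where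
  "very_greedy_eternal_chromatic_number G = (INF k \<in> {k. alice_wins G k}. enat k)"

end

theory Submission
  imports Defs
begin

text \<open>
  With at least three colours a leaf can always be recoloured, so only the centre can get stuck.
  Alice plays it as soon as it is available: first in the rounds that she starts, and at the latest
  second in the rounds that Bob starts. For odd \<open>n\<close> she starts every round, all leaves have the same
  colour between rounds, and three colours suffice. For even \<open>n\<close> Bob starts every other round; he
  can make at most one leaf deviate before the centre is played, and with four colours this never
  produces a centre of colour 4 whose leaves have all of the colours 1, 2, 3.

  Conversely, after the first round the centre and all leaves have the two colours 1 and 2. Two
  colours therefore never suffice, and with three colours and even \<open>n \<ge> 4\<close> Bob recolours one leaf to
  3; whatever Alice does, some leaf keeps its old colour and Bob chooses the stuck centre.
\<close>

section \<open>Rounds\<close>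

definition balanced :: "('a, 'b) pre_digraph \<Rightarrow> 'a list \<Rightarrow> bool" where
  "balanced G h \<longleftrightarrow> (\<exists>q. \<forall>w\<in>verts G. count_list h w \<in> {q, Suc q})"

lemma balanced_Nil: "balanced G []"
  by (auto simp: balanced_def)

lemma available_Nil: "available G [] = verts G"
  by (auto simp: available_def)

text \<open>An available vertex has the least count, and balance allows only one other value, so the
  available vertices form one level of \<open>count_list\<close>. A move takes \<open>v\<close> out
  of that level; if \<open>v\<close> was alone in it, all counts agree again and a new round
  begins.\<close>

lemma available_snoc:
  assumes "balanced G h" "v \<in> available G h"
  shows "balanced G (h @ [v])"
    and "available G (h @ [v]) =
      (if available G h = {v} then verts G else available G h - {v})"
proof -
  define q where "q = count_list h v"
  have v: "v \<in> verts G" and min: "\<forall>w\<in>verts G. q \<le> count_list h w"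
    using assms(2) by (auto simp: available_def q_def)
  \<comment> \<open>The level \<open>p\<close> given by \<open>balanced\<close> can be one below
    \<open>q\<close>; minimality of \<open>q\<close> then makes all counts equal to
    \<open>q\<close>.\<close>
  have q: "\<forall>w\<in>verts G. count_list h w \<in> {q, Suc q}"
  proof -
    obtain p where p: "\<And>w. w \<in> verts G \<Longrightarrow> count_list h w \<in> {p, Suc p}"
      using assms(1) by (auto simp: balanced_def)
    show ?thesis
    proof
      fix w assume w: "w \<in> verts G"
      show "count_list h w \<in> {q, Suc q}"
        using p[OF v] p[OF w] min w by (fastforce simp: q_def[symmetric])
    qed
  qed
  have av: "available G h = {w \<in> verts G. count_list h w = q}"
    using v min q by (force simp: available_def q_def)
  have count: "count_list (h @ [v]) w = (if w = v then Suc q else count_list h w)" for w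
    by (auto simp: q_def)
  show "balanced G (h @ [v])"
    using q by (auto simp: balanced_def count simp del: count_list_append)
  show "available G (h @ [v]) =
      (if available G h = {v} then verts G else available G h - {v})"
  proof (cases "available G h = {v}")
    case True
    then have "count_list (h @ [v]) w = Suc q" if "w \<in> verts G" for w
      using q that av by (auto simp: count simp del: count_list_append)
    then show ?thesis
      using True by (auto simp: available_def simp del: count_list_append)
  next
    case False
    then obtain u where u: "u \<in> verts G" "u \<noteq> v" "count_list h u = q"
      using assms(2) av by blast
    have "available G (h @ [v]) = available G h - {v}"
      unfolding av using min u
      by (auto simp: available_def count simp del: count_list_append)
        (metis le_antisym)
    then show ?thesis
      using False by simp
  qed
qed

lemma coloring_after_Nil: "coloring_after G k [] = Map.empty"
  by (simp add: coloring_after_def)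

lemma coloring_after_snoc:
  "coloring_after G k (h @ [v]) = greedy_color G k (coloring_after G k h) v"
  by (simp add: coloring_after_def)

lemma play_snocD:
  assumes "play G \<sigma> (h @ [v])"
  shows "play G \<sigma> h" "even (length h) \<Longrightarrow> v = \<sigma> h" "odd (length h) \<Longrightarrow> v \<in> available G h"
  using assms by (auto elim: play.cases)

text \<open>\<open>play\<close> does not check Alice's moves; that they are available comes from
  \<open>\<sigma>\<close> being winning.\<close>

lemma winning_strategy_balanced:
  assumes "winning_strategy G k \<sigma>" "play G \<sigma> h"
  shows "balanced G h"
  using assms(2)
proof (induction h rule: rev_induct)
  case (snoc v h)
  then show ?case
    using assms(1) available_snoc(1) play_snocD(1) by (metis winning_strategy_def)
qed (simp add: balanced_Nil)

lemma greedy_color_legal: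
  assumes "legal_colors G k col v \<noteq> {}"
  obtains x where "x \<in> legal_colors G k col v" "greedy_color G k col v = col(v \<mapsto> x)"
    "\<And>y. y \<in> legal_colors G k col v \<Longrightarrow> x \<le> y"
proof -
  have "finite (legal_colors G k col v)"
    by (simp add: legal_colors_def)
  then show ?thesis
    using assms that[of "Min (legal_colors G k col v)"]
    by (simp add: greedy_color_def)
qed


section \<open>Stars\<close>

text \<open>The colour greedily given to a leaf when the centre has colour \<open>z\<close> and the leaf has
  colour \<open>x\<close>, provided that there are at least three colours.\<close>

definition leaf_color :: "nat option \<Rightarrow> nat option \<Rightarrow> nat" where
  "leaf_color z x =
    (if 1 \<notin> set_option z \<union> set_option x then 1
     else if 2 \<notin> set_option z \<union> set_option x then 2 else 3)"

locale star_game =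
  fixes G :: "('a, 'b) pre_digraph" and c :: 'a and L :: "'a set"
  assumes verts: "verts G = insert c L" and c_notin: "c \<notin> L"
    and finite_L: "finite L" and L_ne: "L \<noteq> {}"
    and dom_c: "\<And>w. c \<rightarrow>\<^bsub>G\<^esub> w \<longleftrightarrow> w \<in> L"
    and dom_leaf: "\<And>l w. l \<in> L \<Longrightarrow> l \<rightarrow>\<^bsub>G\<^esub> w \<longleftrightarrow> w = c"
begin

lemma legal_center:
  "legal_colors G k col c = {x \<in> {1..k}. col c \<noteq> Some x \<and> (\<forall>l\<in>L. col l \<noteq> Some x)}"
  by (auto simp: legal_colors_def dom_c)

lemma legal_leaf:
  "l \<in> L \<Longrightarrow> legal_colors G k col l = {x \<in> {1..k}. col l \<noteq> Some x \<and> col c \<noteq> Some x}"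
  by (auto simp: legal_colors_def dom_leaf)

lemma leaf_color_legal:
  assumes "l \<in> L" "3 \<le> k"
  shows "leaf_color (col c) (col l) \<in> legal_colors G k col l"
  using assms by (cases "col c"; cases "col l") (auto simp: legal_leaf leaf_color_def)

text \<open>A leaf is barred from at most two colours, its own and the centre's, so its least legal
  colour is among 1, 2, 3 and is the same for every \<open>k\<close> from 3 on.\<close>

lemma greedy_leaf:
  assumes "l \<in> L" "3 \<le> k"
  shows "greedy_color G k col l = col(l \<mapsto> leaf_color (col c) (col l))"
proof -
  have "Min (legal_colors G k col l) = leaf_color (col c) (col l)"
  proof (rule Min_eqI)
    show "finite (legal_colors G k col l)"
      by (simp add: legal_colors_def)
    show "leaf_color (col c) (col l) \<le> x" if "x \<in> legal_colors G k col l" for x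
      using that assms
      by (cases "col c"; cases "col l"; cases "x = 1"; cases "x = 2")
         (auto simp: legal_leaf leaf_color_def)
  qed (rule leaf_color_legal[OF assms])
  then show ?thesis
    by (simp add: greedy_color_def)
qed

text \<open>Once the centre has been played, the colouring at the end of the round does not depend on
  the order in which the remaining leaves \<open>A\<close> are played.\<close>

definition finish :: "'a set \<Rightarrow> ('a \<Rightarrow> nat option) \<Rightarrow> ('a \<Rightarrow> nat option)" where
  "finish A col = (\<lambda>v. if v \<in> A then Some (leaf_color (col c) (col v)) else col v)"

lemma finish_empty: "finish {} col = col"
  by (simp add: finish_def)

text \<open>A leaf move changes neither the centre nor another leaf, so the forecast for the end of
  the round stays the same.\<close>

lemma finish_greedy_leaf:
  assumes "l \<in> A" "A \<subseteq> L" "3 \<le> k"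
  shows "finish (A - {l}) (greedy_color G k col l) = finish A col"
proof -
  have "l \<in> L" "l \<noteq> c"
    using assms c_notin by auto
  then show ?thesis
    using assms(1,3) by (auto simp: finish_def greedy_leaf fun_eq_iff)
qed


section \<open>Alice plays the centre as soon as possible\<close>

text \<open>\<open>R e\<close> is meant to hold for the colouring at the start of each round, where \<open>e\<close> tells
  whether Alice moves first in that round. Below, \<open>A\<close> is the set of available vertices and \<open>e\<close>
  tells whether it is Alice's turn.\<close>

definition center_inv ::
    "nat \<Rightarrow> (bool \<Rightarrow> ('a \<Rightarrow> nat option) \<Rightarrow> bool) \<Rightarrow> 'a set \<Rightarrow> bool \<Rightarrow> ('a \<Rightarrow> nat option) \<Rightarrow> bool"
  where
  "center_inv k R A e col \<longleftrightarrow>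
    A = verts G \<and> R e col \<or>
    (\<exists>l\<in>L. A = verts G - {l} \<and> e \<and> legal_colors G k col c \<noteq> {} \<and>
      R (odd (card (verts G))) (finish (L - {l}) (greedy_color G k col c))) \<or>
    A \<noteq> {} \<and> A \<subseteq> L \<and> R (e = even (card A)) (finish A col)"

text \<open>The disjuncts of \<open>center_inv\<close> are the stages of a round: not begun; opened
  by Bob with a leaf \<open>l\<close>, Alice to play the centre; centre played. In the last two the
  colouring at the end of the round is already determined, and \<open>R\<close> is asserted of that
  forecast. The parity of the number of moves left tells who opens the next round.\<close>

lemma center_inv_step:
  assumes k: "3 \<le> k"
    and center_first: "\<And>e col. R e col \<Longrightarrow> legal_colors G k col c \<noteq> {} \<and>
      R (e = even (card (verts G))) (finish L (greedy_color G k col c))"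
    and leaf_first: "\<And>col l. R False col \<Longrightarrow> l \<in> L \<Longrightarrow>
      legal_colors G k (greedy_color G k col l) c \<noteq> {} \<and>
      R (odd (card (verts G)))
        (finish (L - {l}) (greedy_color G k (greedy_color G k col l) c))"
    and inv: "center_inv k R A e col" and v: "v \<in> A" and alice: "e \<Longrightarrow> c \<in> A \<Longrightarrow> v = c"
  shows "legal_colors G k col v \<noteq> {}"
    and "center_inv k R (if A = {v} then verts G else A - {v}) (\<not> e) (greedy_color G k col v)"
proof -
  have card: "card (verts G) = Suc (card L)"
    using c_notin finite_L by (simp add: verts)
  have L': "insert c L - {c} = L"
    using c_notin by auto
  have "legal_colors G k col v \<noteq> {} \<and>
    center_inv k R (if A = {v} then verts G else A - {v}) (\<not> e) (greedy_color G k col v)"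
    using inv unfolding center_inv_def[of k R A e col]
  proof (elim disjE conjE bexE)
    assume A: "A = verts G" and R: "R e col"
    show ?thesis
    proof (cases "v = c")
      case True
      have "A \<noteq> {v}" "A - {v} = L"
        using True A L' L_ne c_notin by (auto simp: verts)
      \<comment> \<open>The centre move passes the turn and lowers the number of moves left by one;
        the two parity changes cancel.\<close>
      moreover have "((\<not> e) = even (card L)) = (e = even (card (verts G)))"
        by (auto simp: card)
      then have "center_inv k R L (\<not> e) (greedy_color G k col c)"
        unfolding center_inv_def using center_first[OF R] L_ne by auto
      ultimately show ?thesis
        using center_first[OF R] True by simp
    next
      case False
      then have l: "v \<in> L" and e: "\<not> e"
        using v A verts alice by auto
      have "A \<noteq> {v}"
        using False A verts by auto
      then show ?thesis
        using leaf_first[OF _ l] R e l leaf_color_legal[OF l k] A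
        by (auto simp: center_inv_def)
    qed
  next
    fix l
    assume l: "l \<in> L" and A: "A = verts G - {l}" and e: "e"
      and legal: "legal_colors G k col c \<noteq> {}"
      and R: "R (odd (card (verts G))) (finish (L - {l}) (greedy_color G k col c))"
    have vc: "v = c"
      using alice e A l c_notin by (auto simp: verts)
    have A': "A - {v} = L - {l}"
      using A vc l c_notin by (auto simp: verts)
    show ?thesis
    \<comment> \<open>With a single leaf the centre is the last vertex of the round.\<close>
    proof (cases "L = {l}")
      case True
      then have "A = {v}"
        using A vc l c_notin by (auto simp: verts)
      moreover have "R (\<not> e) (greedy_color G k col c)"
        using R True e by (simp add: card finish_empty)
      then have "center_inv k R (verts G) (\<not> e) (greedy_color G k col c)"
        unfolding center_inv_def by blast
      ultimately show ?thesis
        using legal vc by simp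
    next
      case False
      then have ne: "A \<noteq> {v}" "L - {l} \<noteq> {}"
        using A' l by auto
      have "card L \<noteq> 0"
        using l finite_L by auto
      then have "even (card (L - {l})) = odd (card L)"
        using l finite_L by simp
      then have "center_inv k R (L - {l}) (\<not> e) (greedy_color G k col c)"
        using R ne(2) e unfolding center_inv_def by (auto simp: card)
      then show ?thesis
        using ne(1) legal vc A' by simp
    qed
  next
    assume A: "A \<noteq> {}" "A \<subseteq> L" and R: "R (e = even (card A)) (finish A col)"
    have l: "v \<in> L"
      using A v by auto
    note fin = finish_greedy_leaf[OF v A(2) k, of col]
    show ?thesis
    proof (cases "A = {v}")
      case True
      then show ?thesis
        using R fin leaf_color_legal[OF l k] by (auto simp: center_inv_def finish_empty)
    next
      case False
      have "finite A"
        using A finite_L finite_subset by auto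
      then have "card A \<noteq> 0" "card (A - {v}) = card A - 1"
        using A v by auto
      then have "even (card (A - {v})) = odd (card A)"
        by simp
      moreover have "A - {v} \<noteq> {}" "A - {v} \<subseteq> L"
        using False A v by auto
      ultimately have "center_inv k R (A - {v}) (\<not> e) (greedy_color G k col v)"
        unfolding center_inv_def using R fin by auto
      then show ?thesis
        using False leaf_color_legal[OF l k] by auto
    qed
  qed
  then show "legal_colors G k col v \<noteq> {}"
    and "center_inv k R (if A = {v} then verts G else A - {v}) (\<not> e) (greedy_color G k col v)"
    by blast+
qed

lemma center_inv_available_ne: "center_inv k R A e col \<Longrightarrow> A \<noteq> {}"
  using c_notin by (auto simp: center_inv_def verts)

text \<open>Once the centre is played the outcome of the round is fixed, so only two openings
  matter: the centre, by either player, or a leaf by Bob followed by the centre. If \<open>R\<close>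
  passes from round to round under both, nobody ever gets stuck.\<close>

lemma alice_wins_center:
  assumes k: "3 \<le> k" and start: "R True Map.empty"
    and center_first: "\<And>e col. R e col \<Longrightarrow> legal_colors G k col c \<noteq> {} \<and>
      R (e = even (card (verts G))) (finish L (greedy_color G k col c))"
    and leaf_first: "\<And>col l. R False col \<Longrightarrow> l \<in> L \<Longrightarrow>
      legal_colors G k (greedy_color G k col l) c \<noteq> {} \<and>
      R (odd (card (verts G)))
        (finish (L - {l}) (greedy_color G k (greedy_color G k col l) c))"
  shows "alice_wins G k"
proof -
  define \<sigma> where
    "\<sigma> h = (if c \<in> available G h then c else SOME l. l \<in> available G h)" for h
  let ?inv = "\<lambda>h. balanced G h \<and>
    center_inv k R (available G h) (even (length h)) (coloring_after G k h)"
  have step: "v \<in> available G h \<and> legal_colors G k (coloring_after G k h) v \<noteq> {} \<and> ?inv (h @ [v])"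
    if inv: "?inv h" and play: "play G \<sigma> (h @ [v])" for h v
  proof -
    have "\<sigma> h \<in> available G h"
      using center_inv_available_ne inv some_in_eq by (metis \<sigma>_def)
    then have v: "v \<in> available G h"
      using play_snocD[OF play] by metis
    have alice: "v = c" if "even (length h)" "c \<in> available G h"
      using play_snocD[OF play] that by (simp add: \<sigma>_def)
    note * = center_inv_step[OF k center_first leaf_first conjunct2[OF inv] v alice]
    show ?thesis
      using available_snoc[OF conjunct1[OF inv] v] * v by (simp add: coloring_after_snoc)
  qed
  have "?inv h" if "play G \<sigma> h" for h
    using that
  proof (induction h rule: rev_induct)
    case Nil
    then show ?case
      using start
      by (simp add: balanced_Nil available_Nil coloring_after_Nil center_inv_def)
  next
    case (snoc v h)
    show ?case
      using step[OF snoc.IH[OF play_snocD(1)[OF snoc.prems]] snoc.prems] by blast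
  qed
  then have "winning_strategy G k \<sigma>"
    unfolding winning_strategy_def using step play_snocD(1)[of G \<sigma>] by meson
  then show ?thesis
    by (auto simp: alice_wins_def)
qed

section \<open>Round invariants for three and for four colours\<close>

lemma leaf_color_range:
  "leaf_color z y \<in> {1, 2, 3}" "z \<noteq> Some (leaf_color z y)" "y \<noteq> Some (leaf_color z y)"
  by (cases z; cases y; auto simp: leaf_color_def)+

lemma greedy_center:
  assumes "legal_colors G k col c \<noteq> {}"
  obtains x where "greedy_color G k col c = col(c \<mapsto> x)" "x \<in> {1..k}" "col c \<noteq> Some x"
    "\<And>l. l \<in> L \<Longrightarrow> col l \<noteq> Some x"
proof -
  obtain x where "x \<in> legal_colors G k col c" "greedy_color G k col c = col(c \<mapsto> x)"
    by (rule greedy_color_legal[OF assms])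
  then show ?thesis
    using that[of x] by (auto simp: legal_center)
qed

lemma legal_center_neI:
  assumes "\<exists>x\<in>X. col c \<noteq> Some x \<and> (\<forall>l\<in>L. col l \<noteq> Some x)" "X \<subseteq> {1..k}"
  shows "legal_colors G k col c \<noteq> {}"
  using assms unfolding legal_center by blast

text \<open>A centre whose leaves share one colour has a third colour free. Leaves with equal old
  colours facing the same new centre get equal new colours, so uniformity persists.\<close>

lemma alice_wins_3:
  assumes "odd (card L)"
  shows "alice_wins G 3"
proof -
  define Q where "Q col \<longleftrightarrow> col = Map.empty \<or>
    (\<exists>a\<in>{1,2,3}. \<exists>b\<in>{1,2,3}. a \<noteq> b \<and> col c = Some a \<and> (\<forall>l\<in>L. col l = Some b))"
    for col :: "'a \<Rightarrow> nat option"
  have even: "even (card (verts G))"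
    using assms c_notin finite_L by (simp add: verts)
  have step: "legal_colors G 3 col c \<noteq> {} \<and> Q (finish L (greedy_color G 3 col c))"
    if "Q col" for col
  proof -
    have legal: "legal_colors G 3 col c \<noteq> {}"
    proof -
      have "\<exists>x\<in>{1,2,3}. col c \<noteq> Some x \<and> (\<forall>l\<in>L. col l \<noteq> Some x)"
        using that by (auto simp: Q_def)
      then show ?thesis
        by (rule legal_center_neI) auto
    qed
    then obtain x where x: "greedy_color G 3 col c = col(c \<mapsto> x)" "x \<in> {1..3}"
      by (rule greedy_center)
    have "\<exists>y. \<forall>l\<in>L. col l = y"
      using that by (auto simp: Q_def)
    then obtain y where y: "\<forall>l\<in>L. col l = y" ..
    have "Q (finish L (col(c \<mapsto> x)))"
      unfolding Q_def
    proof (rule disjI2, intro bexI conjI)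
      show "x \<noteq> leaf_color (Some x) y"
        using leaf_color_range(2) by blast
      show "\<forall>l\<in>L. finish L (col(c \<mapsto> x)) l = Some (leaf_color (Some x) y)"
        using y c_notin by (auto simp: finish_def)
      show "x \<in> {1, 2, 3}"
        using x(2) by auto
    qed (use c_notin leaf_color_range in \<open>auto simp: finish_def\<close>)
    then show ?thesis
      using legal x by simp
  qed
  \<comment> \<open>The number of vertices is even, so \<open>e\<close> persists; as a conjunct of
    \<open>R\<close> it makes the condition on rounds opened by Bob vacuous.\<close>
  show ?thesis
    by (rule alice_wins_center[where R = "\<lambda>e col. e \<and> Q col"])
      (use step even in \<open>auto simp: Q_def\<close>)
qed

text \<open>Leaves only use 1, 2, 3, so 4 is legal for any centre of another colour and only centre
  4 is dangerous. Under a new centre 4 every leaf played afterwards becomes 1 or 2, so only a leaf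
  that Bob played earlier in the round can have 3.\<close>

lemma alice_wins_4:
  assumes "even (card L)"
  shows "alice_wins G 4"
proof -
  \<comment> \<open>\<open>E\<close> holds before the rounds started by Alice, \<open>F\<close> before those started by Bob. The last
    clause of \<open>F'\<close> is needed because with centre 2, leaves 1, 1, 3 and Bob recolouring a leaf 1
    to 3, the centre becomes 4 and the leaves end up as 3, 2, 1.\<close>
  define E' where "E' a col \<longleftrightarrow> col c = Some a \<and>
      (\<forall>l\<in>L. col l \<in> Some ` {1,2,3} - {Some a}) \<and>
      (a = 4 \<longrightarrow> (\<forall>l\<in>L. \<forall>l'\<in>L. col l = Some 3 \<longrightarrow> col l' = Some 3 \<longrightarrow> l = l') \<and>
        (\<exists>x\<in>{1,2,3}. \<forall>l\<in>L. col l \<noteq> Some x))"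
    for a and col :: "'a \<Rightarrow> nat option"
  define F' where "F' a col \<longleftrightarrow> col c = Some a \<and>
      (\<forall>l\<in>L. col l \<in> Some ` {1,2,3} - {Some a}) \<and>
      (a = 4 \<longrightarrow> (\<forall>l\<in>L. col l \<noteq> Some 3)) \<and>
      (a = 2 \<longrightarrow> (\<forall>l\<in>L. col l \<noteq> Some 3) \<or>
        (\<forall>l\<in>L. \<forall>l'\<in>L. col l = Some 1 \<longrightarrow> col l' = Some 1 \<longrightarrow> l = l'))"
    for a and col :: "'a \<Rightarrow> nat option"
  define E where "E col \<longleftrightarrow> (\<exists>a\<in>{1..4}. E' a col)" for col
  define F where "F col \<longleftrightarrow> (\<exists>a\<in>{1..4}. F' a col)" for col
  have odd: "odd (card (verts G))"
    using assms c_notin finite_L by (simp add: verts)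
  have fin: "finish L (col(c \<mapsto> x)) c = Some x"
    "l \<in> L \<Longrightarrow> finish L (col(c \<mapsto> x)) l = Some (leaf_color (Some x) (col l))"
    for col x l
    using c_notin by (auto simp: finish_def)
  have leaf: "leaf_color (Some x) z \<in> {1,2,3} - {x}" for x z
    using leaf_color_range(1)[of "Some x" z] leaf_color_range(2)[of "Some x" z] by auto
  have leaf4: "leaf_color (Some 4) z \<noteq> 3" for z
    by (cases z) (auto simp: leaf_color_def)
  have start: "legal_colors G 4 Map.empty c \<noteq> {} \<and>
    F (finish L (greedy_color G 4 Map.empty c))"
  proof -
    have legal: "legal_colors G 4 Map.empty c \<noteq> {}"
      by (rule legal_center_neI[where X = "{1}"]) auto
    then obtain x where x: "greedy_color G 4 Map.empty c = Map.empty(c \<mapsto> x)" "x \<in> {1..4}"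
      by (rule greedy_center)
    have "F (finish L (Map.empty(c \<mapsto> x)))"
      unfolding F_def F'_def using x(2) leaf leaf4
      by (intro bexI[of _ x]) (auto simp: fin leaf_color_def)
    then show ?thesis
      using legal x by simp
  qed
  have E_step: "legal_colors G 4 col c \<noteq> {} \<and> F (finish L (greedy_color G 4 col c))"
    if E: "E col" for col
  proof -
    obtain a where "a \<in> {1..4}" and E': "E' a col"
      using E unfolding E_def by blast
    then have a: "a \<in> {1,2,3,4}" "col c = Some a"
      "\<forall>l\<in>L. col l \<in> Some ` {1,2,3} - {Some a}"
      "a = 4 \<Longrightarrow> \<forall>l\<in>L. \<forall>l'\<in>L. col l = Some 3 \<longrightarrow> col l' = Some 3 \<longrightarrow> l = l'"
      "a = 4 \<Longrightarrow> \<exists>x\<in>{1,2,3}. \<forall>l\<in>L. col l \<noteq> Some x"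
      unfolding E'_def by (simp_all, linarith)
    have "\<exists>x\<in>{1,2,3,4}. col c \<noteq> Some x \<and> (\<forall>l\<in>L. col l \<noteq> Some x)"
    proof (cases "a = 4")
      case True
      then show ?thesis
        using a(2,5) by auto
    next
      case False
      then show ?thesis
        using a(2,3) by (intro bexI[of _ 4]) auto
    qed
    then have legal: "legal_colors G 4 col c \<noteq> {}"
      by (rule legal_center_neI) auto
    then obtain x where x: "greedy_color G 4 col c = col(c \<mapsto> x)" "x \<in> {1..4}"
      "col c \<noteq> Some x" "\<And>l. l \<in> L \<Longrightarrow> col l \<noteq> Some x"
      by (rule greedy_center) blast
    have two: "(\<forall>l\<in>L. finish L (col(c \<mapsto> x)) l \<noteq> Some 3) \<or>
      (\<forall>l\<in>L. \<forall>l'\<in>L. finish L (col(c \<mapsto> x)) l = Some 1 \<longrightarrow>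
        finish L (col(c \<mapsto> x)) l' = Some 1 \<longrightarrow> l = l')" if "x = 2"
    proof -
      have new: "finish L (col(c \<mapsto> x)) l = (if col l = Some 1 then Some 3 else Some 1)"
        "col l \<in> {Some 1, Some 3}" if "l \<in> L" for l
        using a(3) x(4)[OF that] that \<open>x = 2\<close> by (auto simp: fin leaf_color_def)
      \<comment> \<open>The leaves are 1 or 3 and exchange these colours. Old centre 1: all turn
        from 3 to 1. Old centre 3: all turn from 1 to 3. Old centre 4: by the uniqueness clause of
        \<open>E'\<close> at most one was 3, so at most one is now 1.\<close>
      consider "a = 1" | "a = 3" | "a = 4"
        using a(1,2) x(3) \<open>x = 2\<close> by auto
      then show ?thesis
      proof cases
        case 1
        then show ?thesis
          using a(3) new(1) by auto
      next
        case 2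
        then have "\<forall>l\<in>L. finish L (col(c \<mapsto> x)) l \<noteq> Some 1"
          using a(3) new by auto
        then show ?thesis
          by auto
      next
        case 3
        have "col l = Some 3" if "l \<in> L" "finish L (col(c \<mapsto> x)) l = Some 1" for l
        proof (cases "col l = Some 1")
          case True
          then show ?thesis
            using new(1)[OF that(1)] that(2) by simp
        next
          case False
          then show ?thesis
            using new(2)[OF that(1)] by simp
        qed
        then have "\<forall>l\<in>L. \<forall>l'\<in>L. finish L (col(c \<mapsto> x)) l = Some 1 \<longrightarrow>
          finish L (col(c \<mapsto> x)) l' = Some 1 \<longrightarrow> l = l'"
          using a(4)[OF 3] by (intro ballI impI) simp
        then show ?thesis ..
      qed
    qed
    have "F (finish L (col(c \<mapsto> x)))"
      unfolding F_def F'_def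
    proof (rule bexI[of _ x], intro conjI impI two)
      show "\<forall>l\<in>L. finish L (col(c \<mapsto> x)) l \<in> Some ` {1,2,3} - {Some x}"
        using leaf by (auto simp: fin)
    qed (use x(2) leaf4 in \<open>auto simp: fin\<close>)
    then show ?thesis
      using legal x by simp
  qed
  have F_center: "legal_colors G 4 col c \<noteq> {} \<and> E (finish L (greedy_color G 4 col c))"
    if "F col" for col
  proof -
    \<comment> \<open>Under centre 4 no leaf has 3 by \<open>F'\<close>, so 3 is free; otherwise 4
      is free.\<close>
    have "\<exists>x\<in>{3,4}. col c \<noteq> Some x \<and> (\<forall>l\<in>L. col l \<noteq> Some x)"
      using that by (auto simp: F_def F'_def)
    then have legal: "legal_colors G 4 col c \<noteq> {}"
      by (rule legal_center_neI) auto
    then obtain x where x: "greedy_color G 4 col c = col(c \<mapsto> x)" "x \<in> {1..4}"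
      by (rule greedy_center)
    have "E (finish L (col(c \<mapsto> x)))"
      unfolding E_def E'_def
    proof (rule bexI[of _ x], intro conjI impI)
      show "\<forall>l\<in>L. finish L (col(c \<mapsto> x)) l \<in> Some ` {1,2,3} - {Some x}"
        using leaf by (auto simp: fin)
      show "\<exists>y\<in>{1,2,3}. \<forall>l\<in>L. finish L (col(c \<mapsto> x)) l \<noteq> Some y" if "x = 4"
        using that leaf4 by (intro bexI[of _ 3]) (auto simp: fin)
    qed (use x(2) leaf4 in \<open>auto simp: fin\<close>)
    then show ?thesis
      using legal x by simp
  qed
  have F_leaf: "legal_colors G 4 (greedy_color G 4 col l) c \<noteq> {} \<and>
      E (finish (L - {l}) (greedy_color G 4 (greedy_color G 4 col l) c))"
    if F: "F col" and l: "l \<in> L" for col l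
  proof -
    obtain a where "a \<in> {1..4}" and F': "F' a col"
      using F unfolding F_def by blast
    then have a: "a \<in> {1,2,3,4}" "col c = Some a"
      "\<forall>l\<in>L. col l \<in> Some ` {1,2,3} - {Some a}"
      "a = 4 \<Longrightarrow> \<forall>l\<in>L. col l \<noteq> Some 3"
      "a = 2 \<Longrightarrow> (\<forall>l\<in>L. col l \<noteq> Some 3) \<or>
        (\<forall>l\<in>L. \<forall>l'\<in>L. col l = Some 1 \<longrightarrow> col l' = Some 1 \<longrightarrow> l = l')"
      unfolding F'_def by (simp_all, linarith)
    \<comment> \<open>Bob's leaf deviates because it is recoloured against the old centre
      \<open>a\<close>, the other leaves against the new centre \<open>x\<close>.\<close>
    define y where "y = leaf_color (Some a) (col l)"
    have y: "y \<in> {1,2,3}" "y \<noteq> a" "col l \<noteq> Some y"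
      unfolding y_def using leaf_color_range[where z = "Some a" and y = "col l"] by auto
    have c1: "greedy_color G 4 col l = col(l \<mapsto> y)"
      using greedy_leaf[OF l, of 4 col] a(2) by (simp add: y_def)
    have lc: "l \<noteq> c"
      using l c_notin by auto
    have "\<exists>x\<in>{3,4}. (col(l \<mapsto> y)) c \<noteq> Some x \<and> (\<forall>l'\<in>L. (col(l \<mapsto> y)) l' \<noteq> Some x)"
    proof (cases "a = 4")
      case True
      then have "y \<noteq> 3"
        using leaf4 by (simp add: y_def)
      then show ?thesis
        using a(2,4) True lc by (intro bexI[of _ 3]) auto
    next
      case False
      then show ?thesis
        using a(2,3) y(1) lc by (intro bexI[of _ 4]) auto
    qed
    then have legal: "legal_colors G 4 (col(l \<mapsto> y)) c \<noteq> {}"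
      by (rule legal_center_neI) auto
    then obtain x where x: "greedy_color G 4 (col(l \<mapsto> y)) c = (col(l \<mapsto> y))(c \<mapsto> x)"
      "x \<in> {1..4}" "(col(l \<mapsto> y)) c \<noteq> Some x" "\<And>l'. l' \<in> L \<Longrightarrow> (col(l \<mapsto> y)) l' \<noteq> Some x"
      by (rule greedy_center) blast
    let ?new = "finish (L - {l}) ((col(l \<mapsto> y))(c \<mapsto> x))"
    have new: "?new c = Some x" "?new l = Some y"
      "\<And>l'. l' \<in> L \<Longrightarrow> l' \<noteq> l \<Longrightarrow> ?new l' = Some (leaf_color (Some x) (col l'))"
      using lc c_notin by (auto simp: finish_def)
    have xy: "x \<noteq> y" "x \<noteq> a"
      using x(4)[OF l] x(3) lc a(2) by auto
    have missing: "\<exists>z\<in>{1,2,3}. \<forall>l'\<in>L. ?new l' \<noteq> Some z" if x4: "x = 4"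
    proof (cases "y = 3")
      case False
      then have "?new l' \<noteq> Some 3" if "l' \<in> L" for l'
        using new(2,3) that leaf4 x4 by (cases "l' = l") auto
      then show ?thesis
        by auto
    next
      case True
      \<comment> \<open>\<open>y = 3\<close> means that 1 and 2 were barred, so the old centre and
        \<open>l\<close> had these two colours. If the centre had 1, the other leaves had 2 or 3 and
        all become 1.\<close>
      then consider "a = 1" | "a = 2" "col l = Some 1"
        using a(1,2,3) l xy(2) x4 y(2,3) unfolding y_def by (force simp: leaf_color_def)
      then show ?thesis
      proof cases
        case 1
        then have "?new l' \<noteq> Some 2" if "l' \<in> L" for l'
          using new(2,3) that True x4 a(3) by (cases "l' = l") (auto simp: leaf_color_def)
        then show ?thesis
          by auto
      next
        case 2
        show ?thesis
        \<comment> \<open>The leaves had 1 or 3. If none had 3, the others turn from 1 to 2 and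
          colour 1 is missing. Otherwise the last clause of \<open>F'\<close> makes \<open>l\<close>
          the only leaf with 1, the others turn from 3 to 1 and colour 2 is missing.\<close>
        proof (cases "\<forall>l'\<in>L. col l' \<noteq> Some 3")
          case no3: True
          then have "?new l' \<noteq> Some 1" if "l' \<in> L" for l'
            using new(2,3) that True x4 a(3) 2 by (cases "l' = l") (auto simp: leaf_color_def)
          then show ?thesis
            by auto
        next
          case False
          then have unique: "\<forall>l\<in>L. \<forall>l'\<in>L. col l = Some 1 \<longrightarrow> col l' = Some 1 \<longrightarrow> l = l'"
            using a(5)[OF 2(1)] by blast
          have "col l' = Some 3" if "l' \<in> L" "l' \<noteq> l" for l'
          proof -
            have "col l' \<noteq> Some 1"
              using unique l that 2(2) by blast
            then show ?thesis
              using bspec[OF a(3) that(1)] 2(1) by auto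
          qed
          then have "?new l' \<noteq> Some 2" if "l' \<in> L" for l'
            using new(2,3) that True x4 by (cases "l' = l") (auto simp: leaf_color_def)
          then show ?thesis
            by auto
        qed
      qed
    qed
    have "E ?new"
      unfolding E_def E'_def
    proof (rule bexI[of _ x], intro conjI impI missing)
      show "\<forall>l'\<in>L. ?new l' \<in> Some ` {1,2,3} - {Some x}"
      proof
        fix l' assume "l' \<in> L"
        then show "?new l' \<in> Some ` {1,2,3} - {Some x}"
          using new(2,3) leaf y(1) xy(1) by (cases "l' = l") auto
      qed
      show "\<forall>l'\<in>L. \<forall>l''\<in>L. ?new l' = Some 3 \<longrightarrow> ?new l'' = Some 3 \<longrightarrow> l' = l''"
        if "x = 4"
        using new(3) leaf4 that by (metis option.inject)
    qed (use x(2) new(1) in auto)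
    then show ?thesis
      using legal x(1) by (simp add: c1)
  qed
  \<comment> \<open>The number of vertices is odd, so the opener alternates and with it
    \<open>E\<close> and \<open>F\<close>; the empty colouring covers the first round.\<close>
  show ?thesis
    by (rule alice_wins_center[where
          R = "\<lambda>e col. if e then col = Map.empty \<or> E col else F col"])
      (use start E_step F_center F_leaf odd in \<open>auto split: if_splits\<close>)
qed


section \<open>Bob's strategy\<close>

lemma available_ne: "available G h \<noteq> {}"
proof -
  have "finite (verts G)" "verts G \<noteq> {}"
    using finite_L by (auto simp: verts)
  then have "arg_min_on (count_list h) (verts G) \<in> available G h"
    by (simp add: available_def arg_min_if_finite arg_min_least)
  then show ?thesis
    by blast
qed

lemma play_extend:
  assumes "play G \<sigma> h"
  shows "\<exists>v. play G \<sigma> (h @ [v])"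
proof (cases "even (length h)")
  case True
  then show ?thesis
    using play.alice[OF assms] by blast
next
  case False
  then show ?thesis
    using play.bob[OF assms] available_ne by blast
qed

lemma play_of_length: "\<exists>h. play G \<sigma> h \<and> length h = m"
proof (induction m)
  case 0
  show ?case
    using play.start by auto
next
  case (Suc m)
  then obtain h where h: "play G \<sigma> h" "length h = m"
    by blast
  then show ?case
    using play_extend by (metis length_append_singleton)
qed

text \<open>Leaves get 1 until the centre is played. The centre gets 1 if it opens the round and 2
  otherwise, and each later leaf gets the other of these two colours. So the order of play matters
  only up to exchanging 1 and 2.\<close>

lemma first_round:
  assumes win: "winning_strategy G k \<sigma>"
    and "play G \<sigma> h" "length h \<le> card (verts G)"
  shows "distinct h \<and> set h \<subseteq> verts G \<and>
    available G h = (if set h = verts G then verts G else verts G - set h) \<and>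
    (\<forall>v. v \<notin> set h \<longrightarrow> coloring_after G k h v = None) \<and>
    (c \<notin> set h \<and> (\<forall>l\<in>set h. coloring_after G k h l = Some 1) \<or>
     (\<exists>x y. {x, y} = {1, 2} \<and> coloring_after G k h c = Some x \<and>
       (\<forall>l\<in>set h - {c}. coloring_after G k h l = Some y)))"
  using assms(2,3)
proof (induction h rule: rev_induct)
  case Nil
  show ?case
    by (auto simp: available_Nil coloring_after_Nil verts)
next
  case (snoc v h)
  let ?col = "coloring_after G k h"
  have play: "play G \<sigma> h"
    using snoc.prems(1) by (rule play_snocD)
  have IH: "distinct h" "set h \<subseteq> verts G"
    "available G h = (if set h = verts G then verts G else verts G - set h)"
    "\<And>v. v \<notin> set h \<Longrightarrow> ?col v = None"
    and IHc: "c \<notin> set h \<and> (\<forall>l\<in>set h. ?col l = Some 1) \<or>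
     (\<exists>x y. {x, y} = {1, 2} \<and> ?col c = Some x \<and> (\<forall>l\<in>set h - {c}. ?col l = Some y))"
    using snoc.IH[OF play] snoc.prems(2) by auto
  have v: "v \<in> available G h" and legal: "legal_colors G k ?col v \<noteq> {}"
    using win snoc.prems(1) by (auto simp: winning_strategy_def)
  have "card (set h) < card (verts G)"
    using IH(1) snoc.prems(2) by (simp add: distinct_card)
  then have ne: "set h \<noteq> verts G"
    by auto
  then have v': "v \<in> verts G" "v \<notin> set h"
    using v IH(3) by auto
  have av: "available G (h @ [v]) =
    (if set (h @ [v]) = verts G then verts G else verts G - set (h @ [v]))"
    using available_snoc(2)[OF winning_strategy_balanced[OF win play] v] IH(2,3) ne v' by auto
  obtain z where z: "z \<in> legal_colors G k ?col v"
    "greedy_color G k ?col v = ?col(v \<mapsto> z)"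
    "\<And>y. y \<in> legal_colors G k ?col v \<Longrightarrow> z \<le> y"
    using greedy_color_legal[OF legal] by blast
  have col: "coloring_after G k (h @ [v]) = ?col(v \<mapsto> z)"
    by (simp add: coloring_after_snoc z(2))
  have z1: "1 \<le> z" "z \<le> k"
    using z(1) by (auto simp: legal_colors_def)
  have "c \<notin> set (h @ [v]) \<and> (\<forall>l\<in>set (h @ [v]). (?col(v \<mapsto> z)) l = Some 1) \<or>
     (\<exists>x y. {x, y} = {1, 2} \<and> (?col(v \<mapsto> z)) c = Some x \<and>
       (\<forall>l\<in>set (h @ [v]) - {c}. (?col(v \<mapsto> z)) l = Some y))"
  proof (cases "v = c")
    case vc: True
    have unc: "?col c = None"
      using v' IH(4) vc by blast
    then have ones: "\<forall>l\<in>set h. ?col l = Some 1"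
      using IHc by auto
    have "\<exists>y. {z, y} = {1, 2} \<and> (\<forall>l\<in>set h. ?col l = Some y)"
    proof (cases "set h = {}")
      case True
      then have "1 \<in> legal_colors G k ?col v"
        using z1 IH(4) vc by (auto simp: legal_center)
      then have "z = 1"
        using z(3) z1 by fastforce
      then show ?thesis
        using True by auto
    next
      case False
      then obtain l where "l \<in> set h" "l \<in> L"
        using IH(2) v'(2) vc verts by (metis equals0I insertE subsetD)
      then have "z \<noteq> 1"
        using z(1) ones vc by (auto simp: legal_center)
      moreover have not2: "?col l \<noteq> Some 2" for l
        using ones IH(4)[of l] by (cases "l \<in> set h") auto
      \<comment> \<open>The legal colour \<open>z\<close> differs from 1, so \<open>k\<close> is at
        least 2.\<close>
      ultimately have "2 \<in> legal_colors G k ?col v"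
        using z1 unc vc not2 by (simp add: legal_center)
      then have "z = 2"
        using z(3) z1 \<open>z \<noteq> 1\<close> by fastforce
      then show ?thesis
        using ones by auto
    qed
    then show ?thesis
      using vc v'(2) by auto
  next
    case False
    then have l: "v \<in> L"
      using v'(1) verts by auto
    have unc: "?col v = None"
      using v' IH(4) by blast
    from IHc show ?thesis
    proof (elim disjE exE conjE)
      assume c: "c \<notin> set h" and ones: "\<forall>l\<in>set h. ?col l = Some 1"
      have "1 \<in> legal_colors G k ?col v"
        using z1 IH(4)[OF c] unc by (auto simp: legal_leaf[OF l])
      then have "z = 1"
        using z(3) z1 by fastforce
      then show ?thesis
        using ones c False by auto
    next
      fix x y :: nat
      assume xy: "{x, y} = {1, 2}" and x: "?col c = Some x"
        and y: "\<forall>l\<in>set h - {c}. ?col l = Some y"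
      have "z \<noteq> x"
        using z(1) x by (auto simp: legal_leaf[OF l])
      then have "y \<in> legal_colors G k ?col v"
        using z1 x xy unc by (auto simp: legal_leaf[OF l] doubleton_eq_iff)
      then have "z = y"
        using z(3)[of y] z1 \<open>z \<noteq> x\<close> xy by (auto simp: doubleton_eq_iff)
      then show ?thesis
        using xy x y False by auto
    qed
  qed
  then show ?case
    using IH(1,2,4) v' av by (auto simp: col)
qed

lemma after_first_round:
  assumes "winning_strategy G k \<sigma>"
  obtains h x y where "play G \<sigma> h" "length h = card (verts G)" "available G h = verts G"
    "{x, y} = {1, 2}" "coloring_after G k h c = Some x"
    "\<And>l. l \<in> L \<Longrightarrow> coloring_after G k h l = Some y"
proof -
  obtain h where h: "play G \<sigma> h" "length h = card (verts G)"
    using play_of_length by blast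
  note * = first_round[OF assms h(1) eq_imp_le[OF h(2)]]
  have set_h: "set h = verts G"
    using * h(2) finite_L by (intro card_subset_eq) (auto simp: distinct_card verts)
  have L: "L \<subseteq> set h - {c}" and c: "c \<in> set h"
    using c_notin by (auto simp: verts set_h)
  have av: "available G h = verts G"
    using * set_h by presburger
  have "\<exists>x y. {x, y} = {1, 2} \<and> coloring_after G k h c = Some x \<and>
       (\<forall>l\<in>set h - {c}. coloring_after G k h l = Some y)"
    using * c by blast
  then obtain x y where xy: "{x, y} = {1, 2}" "coloring_after G k h c = Some x"
    and y: "\<forall>l\<in>set h - {c}. coloring_after G k h l = Some y"
    by blast
  show ?thesis
    using that[OF h av xy] y L by blast
qed

text \<open>After the first round every vertex has one of 1, 2 itself and sees the other on a
  neighbour, so whichever vertex comes next is stuck.\<close>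

lemma not_alice_wins_2:
  assumes "k \<le> 2"
  shows "\<not> alice_wins G k"
proof
  assume "alice_wins G k"
  then obtain \<sigma> where win: "winning_strategy G k \<sigma>"
    by (auto simp: alice_wins_def)
  obtain h x y where h: "play G \<sigma> h" "{x, y} = {1, 2}" "coloring_after G k h c = Some x"
    "\<And>l. l \<in> L \<Longrightarrow> coloring_after G k h l = Some y"
    using after_first_round[OF win] by metis
  obtain v where "play G \<sigma> (h @ [v])"
    using play_extend[OF h(1)] by blast
  then have v: "v \<in> verts G" "legal_colors G k (coloring_after G k h) v \<noteq> {}"
    using win by (auto simp: winning_strategy_def available_def)
  obtain l where l: "l \<in> L" "v = c \<or> v = l"
    using v(1) L_ne verts by auto
  obtain z where "z \<in> legal_colors G k (coloring_after G k h) v"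
    using v(2) by blast
  then have "z \<in> {1..2}" "z \<noteq> x" "z \<noteq> y"
    using assms l h(3) h(4)[OF l(1)] by (auto simp: legal_center legal_leaf)
  then show False
    using h(2) by (auto simp: doubleton_eq_iff)
qed

text \<open>The first round has an odd number of moves, so Bob opens the second. His leaf must take
  the third colour \<open>z\<close>. The centre is then barred from its own \<open>x\<close>, from
  \<open>z\<close>, and from \<open>y\<close> as long as some leaf keeps it; Alice can recolour only
  one leaf before Bob chooses the centre.\<close>

lemma not_alice_wins_3:
  assumes even: "even (card L)" and three: "3 \<le> card L" and k: "k \<le> 3"
  shows "\<not> alice_wins G k"
proof
  assume "alice_wins G k"
  then obtain \<sigma> where win: "winning_strategy G k \<sigma>"
    by (auto simp: alice_wins_def)
  obtain h x y where h: "play G \<sigma> h" "length h = card (verts G)" "available G h = verts G"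
    and xy: "{x, y} = {1, 2}" and x: "coloring_after G k h c = Some x"
    and y: "\<And>l. l \<in> L \<Longrightarrow> coloring_after G k h l = Some y"
    using after_first_round[OF win] by metis
  have odd: "odd (length h)"
    using h(2) even c_notin finite_L by (simp add: verts)
  obtain l\<^sub>1 where l1: "l\<^sub>1 \<in> L"
    using L_ne by blast
  define h\<^sub>1 where "h\<^sub>1 = h @ [l\<^sub>1]"
  have play1: "play G \<sigma> h\<^sub>1"
    using play.bob[OF h(1) odd] h(3) l1 by (simp add: h\<^sub>1_def verts)
  have legal1: "legal_colors G k (coloring_after G k h) l\<^sub>1 \<noteq> {}"
    using win play1 by (simp add: winning_strategy_def h\<^sub>1_def)
  then obtain z where z: "z \<in> legal_colors G k (coloring_after G k h) l\<^sub>1"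
    "greedy_color G k (coloring_after G k h) l\<^sub>1 = (coloring_after G k h)(l\<^sub>1 \<mapsto> z)"
    by (rule greedy_color_legal)
  have "z \<in> {1..3}" "z \<noteq> x" "z \<noteq> y"
    using z(1) x y[OF l1] k by (auto simp: legal_leaf[OF l1])
  then have xyz: "{1..3} \<subseteq> {x, y, z}"
    using xy by (auto simp: doubleton_eq_iff)
  have col1: "coloring_after G k h\<^sub>1 = (coloring_after G k h)(l\<^sub>1 \<mapsto> z)"
    by (simp add: h\<^sub>1_def coloring_after_snoc z(2))
  have lc: "l\<^sub>1 \<noteq> c"
    using l1 c_notin by auto
  have av1: "available G h\<^sub>1 = verts G - {l\<^sub>1}"
    using available_snoc(2)[OF winning_strategy_balanced[OF win h(1)], of l\<^sub>1] h(3) l1 lc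
    by (auto simp: h\<^sub>1_def verts)
  define v where "v = \<sigma> h\<^sub>1"
  define h\<^sub>2 where "h\<^sub>2 = h\<^sub>1 @ [v]"
  have play2: "play G \<sigma> h\<^sub>2"
    using play.alice[OF play1] odd by (simp add: h\<^sub>1_def h\<^sub>2_def v_def)
  have v: "v \<in> verts G - {l\<^sub>1}" "legal_colors G k (coloring_after G k h\<^sub>1) v \<noteq> {}"
    using win play2 av1 by (auto simp: winning_strategy_def h\<^sub>2_def)
  have stuck: "legal_colors G k col c = {}"
    if "col c = Some x" "col l\<^sub>1 = Some z" "l \<in> L" "col l = Some y" for col l
    using that l1 xyz k by (fastforce simp: legal_center)
  \<comment> \<open>Three leaves guarantee one that neither player has touched in this
    round.\<close>
  have "\<not> L \<subseteq> {l\<^sub>1, v}"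
    using three card_mono[of "{l\<^sub>1, v}" L] card_insert_le_m1[of 2 "{v}" l\<^sub>1] by auto
  then obtain l where l: "l \<in> L" "l \<noteq> l\<^sub>1" "l \<noteq> v"
    by blast
  show False
  proof (cases "v = c")
    case True
    then show False
      using v(2) stuck[of "coloring_after G k h\<^sub>1" l] l x y lc by (simp add: col1)
  next
    case False
    have "available G h\<^sub>2 = verts G - {l\<^sub>1} - {v}"
      using available_snoc(2)[OF winning_strategy_balanced[OF win play1], of v] v av1 lc False
      by (auto simp: h\<^sub>2_def verts)
    then have "c \<in> available G h\<^sub>2"
      using lc False by (auto simp: verts)
    then have "play G \<sigma> (h\<^sub>2 @ [c])"
      using play.bob[OF play2] odd by (simp add: h\<^sub>1_def h\<^sub>2_def)
    then have "legal_colors G k (coloring_after G k h\<^sub>2) c \<noteq> {}"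
      using win by (simp add: winning_strategy_def)
    moreover have "coloring_after G k h\<^sub>2 u = coloring_after G k h\<^sub>1 u" if "u \<noteq> v" for u
      using that by (simp add: h\<^sub>2_def coloring_after_snoc greedy_color_def)
    then have "coloring_after G k h\<^sub>2 c = Some x" "coloring_after G k h\<^sub>2 l\<^sub>1 = Some z"
      "coloring_after G k h\<^sub>2 l = Some y"
      using l x y lc False v(1) by (auto simp: col1 simp del: fun_upd_apply) (auto simp: col1)
    ultimately show False
      using stuck l(1) by blast
  qed
qed

end

section \<open>From the two bounds to the chromatic number\<close>

lemma complete_bipartite_star_game:
  assumes "K\<^bsub>1,n\<^esub> G" "n \<ge> 1"
  obtains c L where "star_game G c L" "card L = n"
proof -
  obtain U L where UL: "verts G = U \<union> L" "U \<inter> L = {}" "card U = 1" "card L = n"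
    "arcs_ends G = U \<times> L \<union> L \<times> U"
    using assms(1) unfolding complete_bipartite_digraph_def by blast
  then obtain c where c: "U = {c}"
    using card_1_singletonE by blast
  \<comment> \<open>\<open>card\<close> is 0 on infinite sets and on the empty set, so
    \<open>n \<ge> 1\<close> excludes both.\<close>
  have "finite L" "L \<noteq> {}"
    using UL(4) assms(2) card_gt_0_iff[of L] by auto
  then have "star_game G c L"
    using UL(1,2,5) c by unfold_locales auto
  then show ?thesis
    using UL(4) that by blast
qed

text \<open>The infimum ranges over all winning \<open>j\<close>, so every smaller \<open>j\<close>
  has to be refuted; hence the negative results are stated for all \<open>k\<close> up to a
  bound.\<close>

lemma chromatic_number_eqI:
  assumes "alice_wins G k" "\<And>j. j < k \<Longrightarrow> \<not> alice_wins G j"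
  shows "very_greedy_eternal_chromatic_number G = enat k"
  unfolding very_greedy_eternal_chromatic_number_def
proof (rule antisym)
  show "(INF j\<in>{j. alice_wins G j}. enat j) \<le> enat k"
    using assms(1) by (auto intro: INF_lower)
  show "enat k \<le> (INF j\<in>{j. alice_wins G j}. enat j)"
  proof (rule INF_greatest)
    fix j assume "j \<in> {j. alice_wins G j}"
    then have "k \<le> j"
      using assms(2) by (auto simp flip: not_less)
    then show "enat k \<le> enat j"
      by simp
  qed
qed

theorem theorem4p4:
  fixes G :: "('a, 'b) pre_digraph" and n :: nat
  assumes "n \<ge> 1" and "K\<^bsub>1,n\<^esub> G"
  shows "(odd n \<longrightarrow> very_greedy_eternal_chromatic_number G = 3) \<and>
         (even n \<and> n \<ge> 4 \<longrightarrow> very_greedy_eternal_chromatic_number G = 4)"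
proof -
  obtain c L where "star_game G c L" and n: "card L = n"
    using complete_bipartite_star_game[OF assms(2,1)] .
  then interpret star_game G c L
    by simp
  have "very_greedy_eternal_chromatic_number G = enat 3" if "odd n"
    using that n by (intro chromatic_number_eqI alice_wins_3 not_alice_wins_2) auto
  moreover have "very_greedy_eternal_chromatic_number G = enat 4" if "even n" "n \<ge> 4"
    using that n by (intro chromatic_number_eqI alice_wins_4 not_alice_wins_3) auto
  ultimately show ?thesis
    by (simp add: numeral_eq_enat)
qed

end
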